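(* Let $(X,d)$ be an ultrametric space with at least two points. If $(X,d)$ is not pseudo-complete, then there is no finite $k$-metric basis of $(X,d)$ for any integer $k\ge 1$.
   Context: A metric space $(X,d)$ is ultrametric if $d(x,y)\le\max\{d(x,z),d(z,y)\}$ for all $x,y,z\in X$. Points $x,y\in X$ are distinguished by $z\in X$ if $d(x,z)\neq d(y,z)$. For a positive integer $k$, a set $S\subseteq X$ is a $k$-metric generator for $X$ if any pair of different points of $X$ is distinguished by at least $k$ elements of $S$. A $k$-metric basis is a $k$-metric generator of minimum cardinality in $X$. Write $B_r(x)=\{p\in X: d(x,p)<r\}$, with $B_\infty(x)=X$. Two different points $x,y\in X$ are partners if $d(x,z)\ge d(x,y)$ and $d(y,z)\ge d(x,y)$ for all $z\in X\smallsetminus\{x,y\}$. A point $x$ is partnered if there is $y\in X$ such that $x,y$ are partners. A point $x$ is pseudopartnered if it is not partnered but there is $y\in X$, $y\ne x$, with $d(x,z)\ge d(x,y)$ for all $z\in X\smallsetminus\{x,y\}$. Given a pseudopartnered point $x$, an $x$-pseudopartnering sequence $(x_n)_{n\ge 1}$ with associated distances $(d_n)_{n\ge1}$ is any sequence obtained inductively as follows: $x_1=x$, $d_1=\infty$. Given $x_n,d_n$: if $|B_{d_n}(x_n)|=1$ or $d_n=0$, put $x_{n+1}=x_n$, $d_{n+1}=0$. If $|B_{d_n}(x_n)|>1$, let $I_n=\{d(x_n,z): z\in B_{d_n}(x_n)\smallsetminus\{x_n\}\}$; if $I_n$ has no minimum put $x_{n+1}=x_n$, $d_{n+1}=0$;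 if $I_n$ has a minimum, choose any $x_{n+1}\in\{z\in X: d(x_n,z)=\min I_n\}$ and put $d_{n+1}=d(x_n,x_{n+1})$. A point $z\in X$ is a pseudolimit of a pseudopartnering sequence $(x_n)$ if $d(z,x_n)=d(x_n,x_{n+1})$ for every $n$. $(X,d)$ is pseudo-complete if for every pseudopartnered point $x\in X$: (i) every $x$-pseudopartnering sequence has a pseudolimit, and (ii) at least one $x$-pseudopartnering sequence has a finite number of pseudolimits. *)

theory Defs
  imports "HOL-Analysis.Analysis"
begin

locale Ultrametric_space = Metric_space +
  assumes ultrametric:
    "\<And>x y z. \<lbrakk>x \<in> M; y \<in> M; z \<in> M\<rbrakk> \<Longrightarrow> d x y \<le> max (d x z) (d z y)"


text \<open>In the following definitions, \<open>X\<close> is the underlying set of the space and \<open>d\<close> its distance.\<close>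

definition distinguishes :: "('a \<Rightarrow> 'a \<Rightarrow> real) \<Rightarrow> 'a \<Rightarrow> 'a \<Rightarrow> 'a \<Rightarrow> bool" where
  "distinguishes d z x y \<longleftrightarrow> d x z \<noteq> d y z"

text \<open>The set of distinguishing points may be infinite, so ``at least \<open>k\<close>'' is expressed
  by a finite subset rather than by \<open>card\<close>, which is \<open>0\<close> on infinite sets.\<close>

definition k_metric_generator :: "'a set \<Rightarrow> ('a \<Rightarrow> 'a \<Rightarrow> real) \<Rightarrow> nat \<Rightarrow> 'a set \<Rightarrow> bool" where
  "k_metric_generator X d k S \<longleftrightarrow>
     S \<subseteq> X \<and>
     (\<forall>x\<in>X. \<forall>y\<in>X. x \<noteq> y \<longrightarrow>
        (\<exists>T. T \<subseteq> {z \<in> S. distinguishes d z x y} \<and> finite T \<and> card T = k))"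

text \<open>Minimum cardinality refers to possibly infinite cardinalities, hence \<open>\<lesssim>\<close>.\<close>

definition k_metric_basis :: "'a set \<Rightarrow> ('a \<Rightarrow> 'a \<Rightarrow> real) \<Rightarrow> nat \<Rightarrow> 'a set \<Rightarrow> bool" where
  "k_metric_basis X d k S \<longleftrightarrow>
     k_metric_generator X d k S \<and> (\<forall>T. k_metric_generator X d k T \<longrightarrow> S \<lesssim> T)"

definition partners :: "'a set \<Rightarrow> ('a \<Rightarrow> 'a \<Rightarrow> real) \<Rightarrow> 'a \<Rightarrow> 'a \<Rightarrow> bool" where
  "partners X d x y \<longleftrightarrow>
     x \<in> X \<and> y \<in> X \<and> x \<noteq> y \<and> (\<forall>z \<in> X - {x, y}. d x z \<ge> d x y \<and> d y z \<ge> d x y)"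

definition partnered :: "'a set \<Rightarrow> ('a \<Rightarrow> 'a \<Rightarrow> real) \<Rightarrow> 'a \<Rightarrow> bool" where
  "partnered X d x \<longleftrightarrow> (\<exists>y\<in>X. partners X d x y)"

definition pseudopartnered :: "'a set \<Rightarrow> ('a \<Rightarrow> 'a \<Rightarrow> real) \<Rightarrow> 'a \<Rightarrow> bool" where
  "pseudopartnered X d x \<longleftrightarrow>
     x \<in> X \<and> \<not> partnered X d x \<and>
     (\<exists>y\<in>X. y \<noteq> x \<and> (\<forall>z \<in> X - {x, y}. d x z \<ge> d x y))"

text \<open>Open balls with a possibly infinite radius; the ball of radius \<open>\<infinity>\<close> is all of \<open>X\<close>.\<close>

definition ext_ball :: "'a set \<Rightarrow> ('a \<Rightarrow> 'a \<Rightarrow> real) \<Rightarrow> 'a \<Rightarrow> ereal \<Rightarrow> 'a set" where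
  "ext_ball X d x r = {p \<in> X. ereal (d x p) < r}"

definition ball_distances :: "'a set \<Rightarrow> ('a \<Rightarrow> 'a \<Rightarrow> real) \<Rightarrow> 'a \<Rightarrow> ereal \<Rightarrow> real set" where
  "ball_distances X d x r = {d x z |z. z \<in> ext_ball X d x r - {x}}"

definition is_minimum :: "real \<Rightarrow> real set \<Rightarrow> bool" where
  "is_minimum m I \<longleftrightarrow> m \<in> I \<and> (\<forall>t\<in>I. m \<le> t)"

text \<open>One step from \<open>(x\<^sub>n, d\<^sub>n) = (x, r)\<close> to \<open>(x\<^sub>n\<^sub>+\<^sub>1, d\<^sub>n\<^sub>+\<^sub>1) = (x', r')\<close>.
  It is a relation because \<open>x'\<close> may be any point at the minimal distance.
  For \<open>x \<in> X\<close> and \<open>r > 0\<close> the ball contains \<open>x\<close>, so outside the first branch the ball has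
  more than one (possibly infinitely many) points.\<close>

definition pseudopartnering_step ::
  "'a set \<Rightarrow> ('a \<Rightarrow> 'a \<Rightarrow> real) \<Rightarrow> 'a \<Rightarrow> ereal \<Rightarrow> 'a \<Rightarrow> ereal \<Rightarrow> bool" where
  "pseudopartnering_step X d x r x' r' \<longleftrightarrow>
     (if card (ext_ball X d x r) = 1 \<or> r = 0 then x' = x \<and> r' = 0
      else if \<nexists>m. is_minimum m (ball_distances X d x r) then x' = x \<and> r' = 0
      else x' \<in> {z \<in> X. is_minimum (d x z) (ball_distances X d x r)} \<and> r' = ereal (d x x'))"

text \<open>Sequences are indexed from 1; the values at index 0 are irrelevant.\<close>

definition pseudopartnering_sequence ::
  "'a set \<Rightarrow> ('a \<Rightarrow> 'a \<Rightarrow> real) \<Rightarrow> 'a \<Rightarrow> (nat \<Rightarrow> 'a) \<Rightarrow> (nat \<Rightarrow> ereal) \<Rightarrow> bool" where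
  "pseudopartnering_sequence X d x xs ds \<longleftrightarrow>
     xs 1 = x \<and> ds 1 = \<infinity> \<and>
     (\<forall>n\<ge>1. pseudopartnering_step X d (xs n) (ds n) (xs (Suc n)) (ds (Suc n)))"

definition pseudolimit ::
  "'a set \<Rightarrow> ('a \<Rightarrow> 'a \<Rightarrow> real) \<Rightarrow> (nat \<Rightarrow> 'a) \<Rightarrow> 'a \<Rightarrow> bool" where
  "pseudolimit X d xs z \<longleftrightarrow> z \<in> X \<and> (\<forall>n\<ge>1. d z (xs n) = d (xs n) (xs (Suc n)))"

definition pseudo_complete :: "'a set \<Rightarrow> ('a \<Rightarrow> 'a \<Rightarrow> real) \<Rightarrow> bool" where
  "pseudo_complete X d \<longleftrightarrow>
     (\<forall>x\<in>X. pseudopartnered X d x \<longrightarrow>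
        (\<forall>xs ds. pseudopartnering_sequence X d x xs ds \<longrightarrow> (\<exists>z. pseudolimit X d xs z)) \<and>
        (\<exists>xs ds. pseudopartnering_sequence X d x xs ds \<and> finite {z. pseudolimit X d xs z}))"

end

theory Submission
  imports Defs
begin

text \<open>
  A finite \<open>k\<close>-metric basis is in particular a finite set \<open>S\<close> that distinguishes every pair of
  different points. The existence of such a set forces pseudo-completeness, for the following
  reasons.

  The crucial observation (lemma \<open>equidistant_unless_nearest\<close>) is the isosceles property. Let
  \<open>\<rho>\<close> be the distance from \<open>x\<close> to its nearest other points. A point \<open>s\<close> outside the sphere of
  radius \<open>\<rho>\<close> about \<open>x\<close> is either \<open>x\<close> or farther away than \<open>\<rho>\<close>, and in both cases it sees all
  points of that sphere at the same distance. So only points of \<open>S\<close> on the sphere can distinguish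
  two points of the sphere.

  In a pseudopartnering sequence, as long as it moves, \<open>x\<^sub>n\<^sub>+\<^sub>1\<close> is a nearest neighbour of \<open>x\<^sub>n\<close>, and
  all later terms lie on the same sphere about \<open>x\<^sub>n\<close>, because the steps get strictly shorter. If the
  sequence ever stands still, it is constant from then on and its final value is its only
  pseudolimit. Both halves of pseudo-completeness reduce to this case.

  For the existence of a pseudolimit: if no point of \<open>S\<close> is a pseudolimit, then each \<open>s \<in> S\<close> misses
  the sphere about some \<open>x\<^sub>n\<close> and hence does not distinguish the later terms. As \<open>S\<close> is finite,
  some tail of the sequence is not distinguished by \<open>S\<close> at all, so the sequence stands still.

  For a sequence with finitely many pseudolimits: pick \<open>x\<^sub>n\<^sub>+\<^sub>1\<close> in \<open>S\<close> whenever possible. A sequence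
  that keeps moving has pairwise different terms, so it must leave the finite set \<open>S\<close>. But where
  that happens, the sphere about \<open>x\<^sub>n\<close> contains no point of \<open>S\<close>, so it is a single point. Both
  \<open>x\<^sub>n\<^sub>+\<^sub>1\<close> and \<open>x\<^sub>n\<^sub>+\<^sub>2\<close> lie on it, and the sequence stands still after all.
\<close>

context Ultrametric_space
begin

section \<open>Isosceles triangles\<close>

lemma isosceles:
  assumes "x \<in> M" "y \<in> M" "z \<in> M" and "d y z < d x y"
  shows "d x z = d x y"
  using ultrametric[of x z y] ultrametric[of x y z] assms commute[of z y]
  by (auto simp: max_def split: if_splits)

text \<open>Apart from \<open>x\<close> itself, a point off the sphere lies outside it, so the isosceles property
  gives both distances the value \<open>d s x\<close>.\<close>

lemma equidistant_unless_nearest: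
  assumes "x \<in> M" "s \<in> M" "u \<in> M" "v \<in> M"
    and nearest: "\<And>p. p \<in> M \<Longrightarrow> p \<noteq> x \<Longrightarrow> \<rho> \<le> d x p"
    and off_sphere: "d s x \<noteq> \<rho>"
    and sphere: "d x u = \<rho>" "d x v = \<rho>"
  shows "d s u = d s v"
proof (cases "s = x")
  case True
  then show ?thesis using sphere by simp
next
  case False
  then have "\<rho> < d s x"
    using nearest[of s] assms(2) off_sphere commute[of s x] by fastforce
  then show ?thesis
    using isosceles[of s x u] isosceles[of s x v] assms by simp
qed

section \<open>Pseudopartnering steps\<close>

text \<open>The radius \<open>0\<close>, used as a stop signal, is consistent with the distance covered by the step:
  in all branches the new radius is \<open>d x x'\<close>. The three branches thus collapse to the alternative
  of moving to a nearest neighbour or standing still.\<close>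

lemma step_cases:
  assumes step: "pseudopartnering_step M d x r x' r'" and "x \<in> M"
  obtains (stay) "x' = x" "r' = 0"
  | (move) "x' \<in> M" "x' \<noteq> x" "r' = ereal (d x x')" "ereal (d x x') < r"
      "\<And>p. p \<in> M \<Longrightarrow> p \<noteq> x \<Longrightarrow> d x x' \<le> d x p"
proof (cases "x' = x \<and> r' = 0")
  case True
  then show ?thesis using stay by blast
next
  case False
  then have x': "x' \<in> M" and r': "r' = ereal (d x x')"
    and min: "is_minimum (d x x') (ball_distances M d x r)"
    using step unfolding pseudopartnering_step_def by (auto split: if_splits)
  obtain w where w: "w \<in> M" "w \<noteq> x" "ereal (d x w) < r" "d x x' = d x w"
    using min unfolding is_minimum_def ball_distances_def ext_ball_def by auto
  have "x' \<noteq> x"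
    using w \<open>x \<in> M\<close> by force
  moreover have "ereal (d x x') < r"
    using w by simp
  moreover have "d x x' \<le> d x p" if "p \<in> M" "p \<noteq> x" for p
  proof (cases "ereal (d x p) < r")
    case True
    then have "d x p \<in> ball_distances M d x r"
      using that unfolding ball_distances_def ext_ball_def by blast
    then show ?thesis using min unfolding is_minimum_def by blast
  next
    case False
    then show ?thesis
      using \<open>ereal (d x x') < r\<close> by (metis ereal_less_eq(3) le_less_linear less_le_trans order.asym)
  qed
  ultimately show ?thesis
    using move x' r' by blast
qed

lemma step_from_radius_0:
  assumes "pseudopartnering_step M d x 0 x' r'"
  shows "x' = x"
  using assms unfolding pseudopartnering_step_def by simp

lemma step_exists:
  assumes "x \<in> M"
  shows "\<exists>x' r'. pseudopartnering_step M d x r x' r'"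
proof (cases "(\<exists>m. is_minimum m (ball_distances M d x r)) \<and> card (ext_ball M d x r) \<noteq> 1 \<and> r \<noteq> 0")
  case True
  then obtain m where m: "is_minimum m (ball_distances M d x r)" by blast
  then obtain w where "w \<in> M" "m = d x w"
    unfolding is_minimum_def ball_distances_def ext_ball_def by auto
  then have "pseudopartnering_step M d x r w (ereal (d x w))"
    using True m unfolding pseudopartnering_step_def by auto
  then show ?thesis by blast
next
  case False
  then have "pseudopartnering_step M d x r x 0"
    unfolding pseudopartnering_step_def by auto
  then show ?thesis by blast
qed

text \<open>This freedom in the choice of the next point lets a sequence prefer points of a given set.\<close>

lemma step_to_equidistant:
  assumes step: "pseudopartnering_step M d x r x' r'" and "x \<in> M" "y \<in> M" "d x y = d x x'"
  shows "pseudopartnering_step M d x r y r'"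
  using step \<open>x \<in> M\<close>
proof (cases rule: step_cases)
  case stay
  then have "y = x'" using assms(2-4) zero[of x y] by simp
  then show ?thesis using step by simp
next
  case move
  then show ?thesis
    using step assms(3,4) unfolding pseudopartnering_step_def by (auto split: if_splits)
qed

section \<open>Pseudopartnering sequences\<close>

context
  fixes x0 :: 'a and xs :: "nat \<Rightarrow> 'a" and ds :: "nat \<Rightarrow> ereal"
  assumes x0: "x0 \<in> M" and sequence: "pseudopartnering_sequence M d x0 xs ds"
begin

lemma sequence_step:
  "n \<ge> 1 \<Longrightarrow> pseudopartnering_step M d (xs n) (ds n) (xs (Suc n)) (ds (Suc n))"
  using sequence unfolding pseudopartnering_sequence_def by blast

lemma sequence_in_space: "n \<ge> 1 \<Longrightarrow> xs n \<in> M"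
proof (induction n rule: nat_induct_at_least)
  case base
  then show ?case using x0 sequence unfolding pseudopartnering_sequence_def by simp
next
  case (Suc n)
  show ?case
    using sequence_step[OF \<open>1 \<le> n\<close>] Suc.IH by (cases rule: step_cases) (use Suc.IH in auto)
qed

lemma sequence_radius:
  assumes "n \<ge> 1"
  shows "ds (Suc n) = ereal (d (xs n) (xs (Suc n)))"
  using sequence_step[OF assms] sequence_in_space[OF assms]
  by (cases rule: step_cases) (use sequence_in_space[OF assms] in \<open>auto simp: zero_ereal_def\<close>)

lemma sequence_nearest:
  assumes "n \<ge> 1" "xs (Suc n) \<noteq> xs n" "p \<in> M" "p \<noteq> xs n"
  shows "d (xs n) (xs (Suc n)) \<le> d (xs n) p"
  using sequence_step[OF assms(1)] sequence_in_space[OF assms(1)]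
  by (cases rule: step_cases) (use assms in auto)

lemma sequence_stays:
  assumes "N \<ge> 1" "xs (Suc N) = xs N" "N \<le> m"
  shows "xs m = xs N"
proof -
  have "xs m = xs N \<and> xs (Suc m) = xs m" using \<open>N \<le> m\<close>
  proof (induction m rule: nat_induct_at_least)
    case base
    then show ?case using assms by simp
  next
    case (Suc m)
    have "1 \<le> m" using assms Suc.hyps by simp
    then have "ds (Suc m) = 0"
      using sequence_radius[of m] Suc.IH sequence_in_space[of m] by (simp add: zero_ereal_def)
    then have "xs (Suc (Suc m)) = xs (Suc m)"
      using sequence_step[of "Suc m"] step_from_radius_0 by simp
    then show ?case using Suc.IH by simp
  qed
  then show ?thesis by simp
qed

lemma sequence_steps_shorten:
  assumes "n \<ge> 1" "xs (Suc n) \<noteq> xs n" "n < m"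
  shows "d (xs m) (xs (Suc m)) < d (xs n) (xs (Suc n))"
proof -
  have shorter: "d (xs (Suc i)) (xs (Suc (Suc i))) < d (xs i) (xs (Suc i))"
    if "1 \<le> i" "xs (Suc i) \<noteq> xs i" for i
    using sequence_step[OF le_SucI[OF that(1)]] sequence_in_space[OF le_SucI[OF that(1)]]
  proof (cases rule: step_cases)
    case stay
    then show ?thesis
      using that(1) that(2)[symmetric] sequence_in_space[of i] sequence_in_space[of "Suc i"]
        mdist_pos_less[of "xs i" "xs (Suc i)"] by simp
  next
    case move
    then show ?thesis using sequence_radius[OF that(1)] by simp
  qed
  have "Suc n \<le> m" using assms by simp
  then show ?thesis
  proof (induction m rule: nat_induct_at_least)
    case base
    then show ?case using shorter assms by blast
  next
    case (Suc m)
    show ?case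
    proof (cases "xs (Suc m) = xs m")
      case True
      then have "xs (Suc (Suc m)) = xs m" "xs (Suc m) = xs m"
        using sequence_stays[of m "Suc (Suc m)"] Suc.hyps assms(1) by simp_all
      then show ?thesis using Suc.IH by simp
    next
      case False
      then show ?thesis using shorter[of m] Suc by fastforce
    qed
  qed
qed

text \<open>The terms after \<open>x\<^sub>n\<^sub>+\<^sub>1\<close> stay strictly closer to each other than \<open>x\<^sub>n\<close> is to \<open>x\<^sub>n\<^sub>+\<^sub>1\<close>, so
  they remain on the sphere about \<open>x\<^sub>n\<close>. Every term thus satisfies the equations of a pseudolimit
  that concern its predecessors.\<close>

lemma sequence_sphere:
  assumes "n \<ge> 1" "n < m"
  shows "d (xs n) (xs m) = d (xs n) (xs (Suc n))"
proof (cases "xs (Suc n) = xs n")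
  case True
  then show ?thesis using sequence_stays[of n m] assms by simp
next
  case False
  have "Suc n \<le> m" using assms by simp
  then show ?thesis
  proof (induction m rule: nat_induct_at_least)
    case base
    then show ?case by simp
  next
    case (Suc m)
    then show ?case
      using isosceles[of "xs n" "xs m" "xs (Suc m)"] sequence_steps_shorten[OF assms(1) False, of m]
        sequence_in_space assms(1) by simp
  qed
qed

lemma pseudolimit_of_stationary:
  assumes "N \<ge> 1" "xs (Suc N) = xs N"
  shows "pseudolimit M d xs z \<longleftrightarrow> z = xs N"
proof
  assume "pseudolimit M d xs z"
  then have "z \<in> M" "d z (xs N) = d (xs N) (xs (Suc N))"
    using assms(1) unfolding pseudolimit_def by simp_all
  then show "z = xs N"
    using assms sequence_in_space[of N] by simp
next
  assume z: "z = xs N"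
  have "d (xs N) (xs n) = d (xs n) (xs (Suc n))" if "n \<ge> 1" for n
  proof (cases "n < N")
    case True
    then show ?thesis using sequence_sphere[of n N] that commute by simp
  next
    case False
    then show ?thesis
      using sequence_stays[OF assms, of n] sequence_stays[OF assms, of "Suc n"] by simp
  qed
  then show "pseudolimit M d xs z"
    using z sequence_in_space assms(1) unfolding pseudolimit_def by simp
qed

lemma equidistant_tail:
  assumes "n \<ge> 1" "s \<in> M" "d s (xs n) \<noteq> d (xs n) (xs (Suc n))" "n < i" "n < j"
  shows "d s (xs i) = d s (xs j)"
proof (cases "xs (Suc n) = xs n")
  case True
  then show ?thesis
    using sequence_stays[of n i] sequence_stays[of n j] assms by simp
next
  case False
  have "xs n \<in> M" "xs i \<in> M" "xs j \<in> M"
    using assms by (auto intro: sequence_in_space)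
  then show ?thesis
    using equidistant_unless_nearest[OF _ \<open>s \<in> M\<close> _ _ sequence_nearest[OF assms(1) False] assms(3)
        sequence_sphere[OF assms(1,4)] sequence_sphere[OF assms(1,5)]]
    by blast
qed

section \<open>Finite resolving sets\<close>

lemma pseudolimit_exists:
  assumes "finite S" "S \<subseteq> M"
    and resolving: "\<And>u v. u \<in> M \<Longrightarrow> v \<in> M \<Longrightarrow> (\<And>s. s \<in> S \<Longrightarrow> d s u = d s v) \<Longrightarrow> u = v"
  shows "\<exists>z. pseudolimit M d xs z"
proof (cases "\<exists>s\<in>S. pseudolimit M d xs s")
  case True
  then show ?thesis by blast
next
  case False
  then have "\<forall>s\<in>S. \<exists>n\<ge>1. d s (xs n) \<noteq> d (xs n) (xs (Suc n))"
    using \<open>S \<subseteq> M\<close> unfolding pseudolimit_def by blast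
  then obtain f where f: "\<And>s. s \<in> S \<Longrightarrow> f s \<ge> 1 \<and> d s (xs (f s)) \<noteq> d (xs (f s)) (xs (Suc (f s)))"
    by metis
  define N where "N = Suc (\<Sum>s\<in>S. f s)"
  have "f s < N" if "s \<in> S" for s
    using member_le_sum[of s S f] that \<open>finite S\<close> unfolding N_def by simp
  then have "d s (xs (Suc N)) = d s (xs N)" if "s \<in> S" for s
    using equidistant_tail[of "f s" s "Suc N" N] f that \<open>S \<subseteq> M\<close> less_Suc_eq by blast
  moreover have "N \<ge> 1"
    unfolding N_def by simp
  ultimately have "xs (Suc N) = xs N"
    using resolving[of "xs (Suc N)" "xs N"] sequence_in_space[of N] sequence_in_space[of "Suc N"]
    by simp
  then have "pseudolimit M d xs (xs N)"
    using pseudolimit_of_stationary[OF \<open>N \<ge> 1\<close>, of "xs N"] by simp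
  then show ?thesis ..
qed

text \<open>The hypothesis \<open>greedy\<close> says that a point of \<open>S\<close> is chosen as the next term whenever one is
  available.\<close>

lemma greedy_sequence_stationary:
  assumes "finite S" "S \<subseteq> M"
    and resolving: "\<And>u v. u \<in> M \<Longrightarrow> v \<in> M \<Longrightarrow> (\<And>s. s \<in> S \<Longrightarrow> d s u = d s v) \<Longrightarrow> u = v"
    and greedy: "\<And>n s. n \<ge> 1 \<Longrightarrow> s \<in> S \<Longrightarrow> d (xs n) s = d (xs n) (xs (Suc n)) \<Longrightarrow> xs (Suc n) \<in> S"
  shows "\<exists>N\<ge>1. xs (Suc N) = xs N"
proof (rule ccontr)
  assume "\<not> ?thesis"
  then have moves: "xs (Suc n) \<noteq> xs n" if "n \<ge> 1" for n
    using that by simp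
  have different: "xs i \<noteq> xs j" if "1 \<le> i" "i < j" for i j
  proof
    assume "xs i = xs j"
    then have "d (xs i) (xs (Suc i)) = 0"
      using sequence_sphere[OF that] sequence_in_space[of j] that by simp
    then show False
      using zero[of "xs i" "xs (Suc i)"] moves[of i] sequence_in_space[of i]
        sequence_in_space[of "Suc i"] that(1) by auto
  qed
  have "inj (\<lambda>n. xs (Suc (Suc n)))"
    by (rule linorder_injI) (use different in auto)
  then have "\<not> range (\<lambda>n. xs (Suc (Suc n))) \<subseteq> S"
    using \<open>finite S\<close> finite_subset range_inj_infinite by metis
  then obtain k where "xs (Suc (Suc k)) \<notin> S"
    by blast
  then obtain n where "n \<ge> 1" and outside: "xs (Suc n) \<notin> S"
    using that[of "Suc k"] by simp
  have "d s (xs (Suc (Suc n))) = d s (xs (Suc n))" if "s \<in> S" for s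
  proof -
    have "d s (xs n) \<noteq> d (xs n) (xs (Suc n))"
      using greedy[OF \<open>n \<ge> 1\<close> that] outside commute[of s "xs n"] by auto
    then show ?thesis
      using equidistant_tail[of n s "Suc (Suc n)" "Suc n"] \<open>n \<ge> 1\<close> that \<open>S \<subseteq> M\<close> by auto
  qed
  then have "xs (Suc (Suc n)) = xs (Suc n)"
    using resolving[of "xs (Suc (Suc n))" "xs (Suc n)"] sequence_in_space by simp
  then show False
    using moves[of "Suc n"] by simp
qed

end

lemma greedy_sequence_exists:
  assumes "x \<in> M" "S \<subseteq> M"
  obtains xs ds where "pseudopartnering_sequence M d x xs ds"
    "\<And>n s. n \<ge> 1 \<Longrightarrow> s \<in> S \<Longrightarrow> d (xs n) s = d (xs n) (xs (Suc n)) \<Longrightarrow> xs (Suc n) \<in> S"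
proof -
  define good where "good a b \<longleftrightarrow>
      pseudopartnering_step M d (fst a) (snd a) (fst b) (snd b) \<and>
      (\<forall>s\<in>S. d (fst a) s = d (fst a) (fst b) \<longrightarrow> fst b \<in> S)" for a b :: "'a \<times> ereal"
  have good_exists: "\<exists>b. fst b \<in> M \<and> good a b" if a: "fst a \<in> M" for a
  proof -
    obtain x' r' where step: "pseudopartnering_step M d (fst a) (snd a) x' r'"
      using step_exists[OF a] by blast
    have "x' \<in> M"
      using step a by (cases rule: step_cases) (use a in auto)
    show ?thesis
    proof (cases "\<exists>s\<in>S. d (fst a) s = d (fst a) x'")
      case True
      then obtain s where s: "s \<in> S" "d (fst a) s = d (fst a) x'" by blast
      then have "s \<in> M" using \<open>S \<subseteq> M\<close> by blast
      then have "good a (s, r')"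
        using step_to_equidistant[OF step a] s unfolding good_def by simp
      then show ?thesis using \<open>s \<in> M\<close> by (metis fst_conv)
    next
      case False
      then have "good a (x', r')" using step unfolding good_def by auto
      then show ?thesis using \<open>x' \<in> M\<close> by (metis fst_conv)
    qed
  qed
  have "\<exists>f. \<forall>n. (fst (f n) \<in> M \<and> (n = 0 \<longrightarrow> f n = (x, \<infinity>))) \<and> good (f n) (f (Suc n))"
    by (rule dependent_nat_choice) (use \<open>x \<in> M\<close> good_exists in auto)
  then obtain f where f0: "f 0 = (x, \<infinity>)" and f: "\<And>n. good (f n) (f (Suc n))"
    by blast
  have good: "good (f (n - 1)) (f n)" if "n \<ge> 1" for n
    using f[of "n - 1"] that by simp
  show ?thesis
  proof (rule that[of "\<lambda>n. fst (f (n - 1))" "\<lambda>n. snd (f (n - 1))"])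
    show "pseudopartnering_sequence M d x (\<lambda>n. fst (f (n - 1))) (\<lambda>n. snd (f (n - 1)))"
      using f0 good unfolding pseudopartnering_sequence_def good_def by simp
    show "fst (f (Suc n - 1)) \<in> S"
      if "n \<ge> 1" "s \<in> S" "d (fst (f (n - 1))) s = d (fst (f (n - 1))) (fst (f (Suc n - 1)))" for n s
      using good[OF that(1)] that(2,3) unfolding good_def by auto
  qed
qed

lemma pseudo_complete_if_finite_resolving:
  assumes "finite S" "S \<subseteq> M"
    and resolving: "\<And>u v. u \<in> M \<Longrightarrow> v \<in> M \<Longrightarrow> (\<And>s. s \<in> S \<Longrightarrow> d s u = d s v) \<Longrightarrow> u = v"
  shows "pseudo_complete M d"
  unfolding pseudo_complete_def
proof (intro ballI impI conjI allI)
  fix x xs ds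
  assume "x \<in> M" "pseudopartnering_sequence M d x xs ds"
  then show "\<exists>z. pseudolimit M d xs z"
    by (rule pseudolimit_exists[OF _ _ assms(1,2)]) (fact resolving)
next
  fix x assume "x \<in> M"
  obtain xs ds where xs: "pseudopartnering_sequence M d x xs ds"
    and greedy: "\<And>n s. n \<ge> 1 \<Longrightarrow> s \<in> S \<Longrightarrow> d (xs n) s = d (xs n) (xs (Suc n)) \<Longrightarrow> xs (Suc n) \<in> S"
    using greedy_sequence_exists[OF \<open>x \<in> M\<close> \<open>S \<subseteq> M\<close>] by blast
  have "\<exists>N\<ge>1. xs (Suc N) = xs N"
    by (rule greedy_sequence_stationary[OF \<open>x \<in> M\<close> xs assms(1,2)]) (fact resolving, fact greedy)
  then obtain N where "N \<ge> 1" "xs (Suc N) = xs N" by blast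
  then have "{z. pseudolimit M d xs z} = {xs N}"
    using pseudolimit_of_stationary[OF \<open>x \<in> M\<close> xs] by simp
  then show "\<exists>xs ds. pseudopartnering_sequence M d x xs ds \<and> finite {z. pseudolimit M d xs z}"
    using xs by (metis finite.emptyI finite.insertI)
qed

lemma k_metric_generator_resolving:
  assumes "k_metric_generator M d k S" "k \<ge> 1" "u \<in> M" "v \<in> M"
    and "\<And>s. s \<in> S \<Longrightarrow> d s u = d s v"
  shows "u = v"
proof (rule ccontr)
  assume "u \<noteq> v"
  then obtain T where T: "T \<subseteq> {z \<in> S. distinguishes d z u v}" "card T = k"
    using assms(1,3,4) unfolding k_metric_generator_def by blast
  then obtain s where "s \<in> T"
    using \<open>k \<ge> 1\<close> by fastforce
  then show False
    using T(1) assms(5)[of s] commute unfolding distinguishes_def by auto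
qed

end

theorem proposition2p25:
  fixes X :: "'a set" and d :: "'a \<Rightarrow> 'a \<Rightarrow> real" and k :: nat
  assumes "Ultrametric_space X d"
    and "\<exists>x\<in>X. \<exists>y\<in>X. x \<noteq> y"
    and "\<not> pseudo_complete X d"
    and "k \<ge> 1"
  shows "\<not> (\<exists>S. finite S \<and> k_metric_basis X d k S)"
proof
  interpret Ultrametric_space X d by (rule assms(1))
  assume "\<exists>S. finite S \<and> k_metric_basis X d k S"
  then obtain S where "finite S" and S: "k_metric_generator X d k S"
    unfolding k_metric_basis_def by blast
  have "S \<subseteq> X"
    using S unfolding k_metric_generator_def by blast
  with \<open>finite S\<close> have "pseudo_complete X d"
    by (rule pseudo_complete_if_finite_resolving) (rule k_metric_generator_resolving[OF S \<open>k \<ge> 1\<close>])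
  then show False
    using assms(3) by blast
qed

end
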